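(* Let $G=(V(G),E(G))$ be a finite weighted connected discrete graph and let $u_0\in L^2(V(G),\nu_G)$. Then, for all $t\ge 0$, $$\|e^{t\Delta_1^{m^G}}u_0-\nu(u_0)\|_{L^2(V(G),\nu_G)}\le\lambda^2_{[V(G),d_G,m^G,\nu_G]}\,(\hat t-t)^+,$$ where $\hat t:=\dfrac{\|u_0-\nu(u_0)\|_{L^2(V(G),\nu_G)}}{\lambda^2_{[V(G),d_G,m^G,\nu_G]}}$. Consequently, $$e^{t\Delta_1^{m^G}}u_0=\nu(u_0)\qquad\text{for all } t\ge\hat t.$$
   Context: $G$ has finite vertex set $V(G)$; each edge $(x,y)\in E(G)$ (written $x\sim y$; loops allowed) carries a weight $w_{xy}=w_{yx}>0$, and $w_{xy}=0$ if $(x,y)\notin E(G)$. Connected means any two vertices are joined by a path of edges; $d_G$ is the graph distance. For $x\in V(G)$, $d_x:=\sum_{y\in V(G)}w_{xy}$ (positive), $m^G_x:=\frac1{d_x}\sum_{y\sim x}w_{xy}\delta_y$, and $\nu_G(A):=\sum_{x\in A}d_x$ for $A\subset V(G)$. For $u:V(G)\to\mathbb R$, $TV_{m^G}(u)=\frac12\sum_{x,y\in V(G)}|u(y)-u(x)|\,w_{xy}$, and $\nu(u):=\frac1{\nu_G(V(G))}\int_{V(G)}u\,d\nu_G$. Put $$\lambda^2_{[V(G),d_G,m^G,\nu_G]}=\inf\left\{\frac{TV_{m^G}(u)}{\|u\|_{L^2(V(G),\nu_G)}}:\ \|u\|_{L^2(V(G),\nu_G)}\ne0,\ \int_{V(G)}u\,d\nu_G=0\right\},$$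 which is positive. The multivalued operator $\Delta_1^{m^G}$ in $L^2(V(G),\nu_G)$ is minus the subdifferential of $TV_{m^G}$: $v\in\Delta_1^{m^G}u$ iff $TV_{m^G}(z)\ge TV_{m^G}(u)-\int_{V(G)}v(z-u)\,d\nu_G$ for all $z\in L^2(V(G),\nu_G)$. $t\mapsto e^{t\Delta_1^{m^G}}u_0$ is the unique $u$ with $u\in W^{1,1}(0,T;L^2(V(G),\nu_G))$ for every $T>0$, $u(0)=u_0$ and $u_t(t)\in\Delta_1^{m^G}u(t)$ for almost all $t>0$. $r^+=\max\{r,0\}$. *)

theory Defs
  imports "HOL-Analysis.Analysis"
begin

text \<open>
  The vertex set \<open>V(G)\<close> is a finite type \<open>'v\<close>. Since it is finite, every real function on it is
  square integrable, so the elements of \<open>L\<^sup>2(V(G), \<nu>\<^sub>G)\<close> are the vectors \<open>real ^ 'v\<close>; the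
  weighted norm is \<open>L2_norm\<close> below, not the Euclidean norm of that type.
\<close>

definition deg :: "('v::finite \<Rightarrow> 'v \<Rightarrow> real) \<Rightarrow> 'v \<Rightarrow> real" where
  "deg w x = (\<Sum>y\<in>UNIV. w x y)"

locale weighted_connected_graph =
  fixes E :: "('v::finite \<times> 'v) set" and w :: "'v \<Rightarrow> 'v \<Rightarrow> real"
  assumes sym_edges: "sym E"
    and weight_sym: "w x y = w y x"
    and weight_pos: "(x, y) \<in> E \<Longrightarrow> w x y > 0"
    and weight_zero: "(x, y) \<notin> E \<Longrightarrow> w x y = 0"
    and connected: "(x, y) \<in> E\<^sup>*"
    and deg_pos: "deg w x > 0" \<comment> \<open>only excludes the single vertex without a loop\<close>

definition nu :: "('v::finite \<Rightarrow> 'v \<Rightarrow> real) \<Rightarrow> 'v measure" where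
  "nu w = point_measure UNIV (\<lambda>x. ennreal (deg w x))"

definition L2_norm :: "('v::finite \<Rightarrow> 'v \<Rightarrow> real) \<Rightarrow> real ^ 'v \<Rightarrow> real" where
  "L2_norm w u = sqrt (\<integral>x. (u $ x)\<^sup>2 \<partial>nu w)"

definition mean :: "('v::finite \<Rightarrow> 'v \<Rightarrow> real) \<Rightarrow> real ^ 'v \<Rightarrow> real" where
  "mean w u = 1 / measure (nu w) UNIV * (\<integral>x. u $ x \<partial>nu w)"

definition TV :: "('v::finite \<Rightarrow> 'v \<Rightarrow> real) \<Rightarrow> real ^ 'v \<Rightarrow> real" where
  "TV w u = 1 / 2 * (\<Sum>x\<in>UNIV. \<Sum>y\<in>UNIV. \<bar>u $ y - u $ x\<bar> * w x y)"

text \<open>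
  On a one-vertex graph the infimum runs over the empty set, and the real \<open>Inf {}\<close> is an
  unspecified number instead of \<open>+\<infinity>\<close>. There \<open>u = \<nu>(u)\<close> for all \<open>u\<close>, and the value plays no role
  in the decay estimate, both sides of which vanish.
\<close>

definition lambda2 :: "('v::finite \<Rightarrow> 'v \<Rightarrow> real) \<Rightarrow> real" where
  "lambda2 w = Inf {TV w u / L2_norm w u | u. L2_norm w u \<noteq> 0 \<and> (\<integral>x. u $ x \<partial>nu w) = 0}"

definition Delta1 :: "('v::finite \<Rightarrow> 'v \<Rightarrow> real) \<Rightarrow> real ^ 'v \<Rightarrow> (real ^ 'v) set" where
  "Delta1 w u = {v. \<forall>z. TV w z \<ge> TV w u - (\<integral>x. v $ x * (z $ x - u $ x) \<partial>nu w)}"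

text \<open>
  \<open>u \<in> W\<^sup>1\<^sup>,\<^sup>1(0, T; X)\<close> with derivative \<open>u\<^sub>t = g\<close>, in the form used by Brezis for evolution
  equations: \<open>u\<close> is (the continuous representative) a primitive of the Bochner integrable
  function \<open>g\<close>. The derivative \<open>g\<close> is determined almost everywhere. For \<open>X = L\<^sup>2(V(G), \<nu>\<^sub>G)\<close> the
  Euclidean norm of \<open>real ^ 'v\<close> may be used, because it is equivalent to \<open>L2_norm\<close> when all
  degrees are positive, so that Bochner integrability and integrals are the same.
\<close>

definition W11_derivative ::
    "real \<Rightarrow> (real \<Rightarrow> 'b::euclidean_space) \<Rightarrow> (real \<Rightarrow> 'b) \<Rightarrow> bool" where
  "W11_derivative T u g \<longleftrightarrow>
     set_integrable lborel {0..T} g \<and>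
     (\<forall>t\<in>{0..T}. u t = u 0 + (LINT s:{0..t}|lborel. g s))"

definition strong_solution ::
    "('v::finite \<Rightarrow> 'v \<Rightarrow> real) \<Rightarrow> real ^ 'v \<Rightarrow> (real \<Rightarrow> real ^ 'v) \<Rightarrow> bool" where
  "strong_solution w u\<^sub>0 u \<longleftrightarrow>
     u 0 = u\<^sub>0 \<and>
     (\<exists>u\<^sub>t. (\<forall>T>0. W11_derivative T u u\<^sub>t) \<and>
           (AE t in lborel. t > 0 \<longrightarrow> u\<^sub>t t \<in> Delta1 w (u t)))"

text \<open>
  \<open>TV_flow w u\<^sub>0 t\<close> is \<open>e\<^bsup>t\<Delta>\<^esup> u\<^sub>0\<close>. The membership in \<open>extensional {0..}\<close> fixes the irrelevant
  values at negative times, so that the solution on \<open>[0, \<infinity>)\<close> is unique as a HOL function.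
\<close>

definition TV_flow :: "('v::finite \<Rightarrow> 'v \<Rightarrow> real) \<Rightarrow> real ^ 'v \<Rightarrow> real \<Rightarrow> real ^ 'v" where
  "TV_flow w u\<^sub>0 = (THE u. u \<in> extensional {0..} \<and> strong_solution w u\<^sub>0 u)"

end

theory Submission
  imports Defs
begin

text \<open>
  After the isometry \<open>u \<mapsto> (sqrt (deg w x) * u $ x)\<^sub>x\<close> from the weighted \<open>L\<^sup>2\<close> space to Euclidean
  space, the total variation becomes a polyhedral seminorm \<open>F a = (\<Sum>i. \<bar>c i \<bullet> a\<bar>)\<close>, and the total
  variation flow becomes the gradient flow \<open>u' \<in> - \<partial>F(u)\<close>.

  Existence. The subdifferential of \<open>F\<close> at \<open>a\<close> depends only on the signs of the numbers \<open>c i \<bullet> a\<close>,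
  so there are finitely many subdifferentials. Starting at \<open>a\<close>, move with velocity \<open>- p\<close>, where \<open>p\<close>
  is the subgradient of minimal norm: it remains a subgradient for a while
  (\<open>steepest_persists\<close>). When it stops to be one, the minimal norm has strictly decreased, and it
  takes finitely many values only; so finitely many segments and a final ray make up a solution
  (\<open>polygonal_flow_exists\<close>). Subgradients are monotone, hence the distance of two solutions does
  not increase, and the polygonal solution is the only one (\<open>gradient_flow_unique\<close>).

  Decay. Let \<open>z\<close> be \<open>u(t)\<close> minus the mean of \<open>u\<^sub>0\<close>. Subgradients are orthogonal to the constants, so
  \<open>z\<close> always has mean zero and \<open>F z \<ge> \<lambda> * norm z\<close>. A subgradient \<open>p\<close> at \<open>u(t)\<close> satisfies \<open>p \<bullet> z = F z\<close>,
  so \<open>norm z\<close> decreases at least at speed \<open>\<lambda>\<close> as long as \<open>z\<close> is nonzero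
  (\<open>polygonal_flow_decay\<close>). The number \<open>\<lambda>\<close> is positive by compactness of the unit sphere, because
  on a connected graph only constants have total variation zero (\<open>Poincare_inequality\<close>).
\<close>

section \<open>Polyhedral seminorms and their subgradients\<close>

definition subgradients :: "('a::euclidean_space \<Rightarrow> real) \<Rightarrow> 'a \<Rightarrow> 'a set" where
  "subgradients F a = {p. \<forall>z. F a + p \<bullet> (z - a) \<le> F z}"

definition abs_sum :: "('i::finite \<Rightarrow> 'a::euclidean_space) \<Rightarrow> 'a \<Rightarrow> real" where
  "abs_sum c a = (\<Sum>i\<in>UNIV. \<bar>c i \<bullet> a\<bar>)"

lemma abs_sum_nonneg: "0 \<le> abs_sum c a"
  by (simp add: abs_sum_def sum_nonneg)

lemma abs_sum_scale: "abs_sum c (r *\<^sub>R a) = \<bar>r\<bar> * abs_sum c a"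
  by (simp add: abs_sum_def abs_mult sum_distrib_left)

lemma abs_sum_add: "abs_sum c (a + b) \<le> abs_sum c a + abs_sum c b"
  unfolding abs_sum_def sum.distrib[symmetric]
  by (rule sum_mono) (simp add: inner_add_right)

lemma continuous_on_abs_sum: "continuous_on S (abs_sum c)"
  unfolding abs_sum_def by (intro continuous_intros)

text \<open>
  For a function that is positively homogeneous, testing the subgradient inequality at \<open>z = 0\<close> and
  \<open>z = 2 a\<close> gives equality in \<open>p \<bullet> a \<le> F a\<close>. Only this equation involves the point \<open>a\<close>.
\<close>

lemma subgradients_abs_sum_iff:
  "p \<in> subgradients (abs_sum c) a \<longleftrightarrow> (\<forall>z. p \<bullet> z \<le> abs_sum c z) \<and> p \<bullet> a = abs_sum c a"
proof
  assume "p \<in> subgradients (abs_sum c) a"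
  then have p: "abs_sum c a + p \<bullet> (z - a) \<le> abs_sum c z" for z
    by (simp add: subgradients_def)
  have "p \<bullet> a = abs_sum c a"
    using p[of 0] p[of "2 *\<^sub>R a"] abs_sum_scale[of c 0 a] abs_sum_scale[of c 2 a]
    by (simp add: inner_diff_right)
  with p show "(\<forall>z. p \<bullet> z \<le> abs_sum c z) \<and> p \<bullet> a = abs_sum c a"
    by (simp add: inner_diff_right)
qed (simp add: subgradients_def inner_diff_right)

lemma norm_subgradient_le:
  assumes "p \<in> subgradients (abs_sum c) a"
  shows "norm p \<le> (\<Sum>i\<in>UNIV. norm (c i))"
proof (cases "p = 0")
  case False
  have "norm p * norm p = p \<bullet> p"
    by (simp add: dot_square_norm power2_eq_square)
  also have "\<dots> \<le> abs_sum c p"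
    using assms by (simp add: subgradients_abs_sum_iff)
  also have "\<dots> \<le> (\<Sum>i\<in>UNIV. norm (c i) * norm p)"
    unfolding abs_sum_def by (intro sum_mono Cauchy_Schwarz_ineq2)
  finally show ?thesis
    using False by (simp add: sum_distrib_right[symmetric])
qed (simp add: sum_nonneg)

lemma subgradient_orthogonal_null:
  assumes "p \<in> subgradients (abs_sum c) a" "abs_sum c e = 0"
  shows "p \<bullet> e = 0"
proof -
  have "p \<bullet> e \<le> abs_sum c e" "p \<bullet> (- e) \<le> abs_sum c (- e)"
    using assms(1) by (simp_all only: subgradients_abs_sum_iff)
  then show ?thesis
    using assms(2) abs_sum_scale[of c "-1" e] by simp
qed

definition sign_gradient :: "('i::finite \<Rightarrow> 'a::euclidean_space) \<Rightarrow> 'a \<Rightarrow> 'a" where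
  "sign_gradient c a = (\<Sum>i\<in>UNIV. sgn (c i \<bullet> a) *\<^sub>R c i)"

lemma sign_gradient_inner_self: "sign_gradient c a \<bullet> a = abs_sum c a"
  by (simp add: sign_gradient_def abs_sum_def inner_sum_left abs_sgn mult.commute)

lemma sign_gradient_subgradient: "sign_gradient c a \<in> subgradients (abs_sum c) a"
proof -
  have "sign_gradient c a \<bullet> z \<le> abs_sum c z" for z
    unfolding sign_gradient_def abs_sum_def inner_sum_left
    by (rule sum_mono) (auto simp: sgn_real_def)
  then show ?thesis
    by (simp add: subgradients_abs_sum_iff sign_gradient_inner_self)
qed

lemma closed_subgradients: "closed (subgradients (abs_sum c) a)"
proof -
  have "subgradients (abs_sum c) a
      = (\<Inter>z. {p. abs_sum c a + p \<bullet> (z - a) \<le> abs_sum c z})"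
    by (auto simp: subgradients_def)
  then show ?thesis
    by (auto intro!: closed_Collect_le continuous_intros)
qed

lemma convex_subgradients: "convex (subgradients (abs_sum c) a)"
proof (rule convexI)
  fix p q :: 'a and \<alpha> \<beta> :: real
  assume "p \<in> subgradients (abs_sum c) a" "q \<in> subgradients (abs_sum c) a"
    and \<alpha>\<beta>: "0 \<le> \<alpha>" "0 \<le> \<beta>" "\<alpha> + \<beta> = 1"
  then have p: "p \<bullet> z \<le> abs_sum c z" "p \<bullet> a = abs_sum c a"
    and q: "q \<bullet> z \<le> abs_sum c z" "q \<bullet> a = abs_sum c a" for z
    by (auto simp: subgradients_abs_sum_iff)
  have "\<alpha> * (p \<bullet> z) + \<beta> * (q \<bullet> z) \<le> \<alpha> * abs_sum c z + \<beta> * abs_sum c z" for z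
    using p q \<alpha>\<beta> by (intro add_mono mult_left_mono) auto
  then show "\<alpha> *\<^sub>R p + \<beta> *\<^sub>R q \<in> subgradients (abs_sum c) a"
    using p q \<alpha>\<beta>
    by (auto simp: subgradients_abs_sum_iff inner_add_left distrib_right[symmetric])
qed

text \<open>
  The hypothesis says that the sign vector of \<open>b\<close> arises from that of \<open>a\<close> by replacing some entries
  by zero. Then the seminorm is affine along \<open>a - \<epsilon> b\<close> for small \<open>\<epsilon> \<ge> 0\<close>, with slope \<open>- F b\<close>. A
  subgradient \<open>p\<close> at \<open>a\<close> stays below it there, which gives \<open>p \<bullet> b \<ge> F b\<close>.
\<close>

lemma subgradients_face:
  assumes face: "\<And>i. c i \<bullet> b \<noteq> 0 \<Longrightarrow> sgn (c i \<bullet> a) = sgn (c i \<bullet> b)"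
  shows "subgradients (abs_sum c) a \<subseteq> subgradients (abs_sum c) b"
proof
  fix p assume "p \<in> subgradients (abs_sum c) a"
  then have p: "p \<bullet> z \<le> abs_sum c z" "p \<bullet> a = abs_sum c a" for z
    by (auto simp: subgradients_abs_sum_iff)
  have "\<forall>\<^sub>F \<epsilon> in at_right (0::real). \<bar>c i \<bullet> a - \<epsilon> * (c i \<bullet> b)\<bar> = \<bar>c i \<bullet> a\<bar> - \<epsilon> * \<bar>c i \<bullet> b\<bar>" for i
  proof (cases "c i \<bullet> b = 0")
    case False
    then have s: "sgn (c i \<bullet> a) = sgn (c i \<bullet> b)" by (rule face)
    have "\<forall>\<^sub>F \<epsilon> in at_right (0::real). \<epsilon> * \<bar>c i \<bullet> b\<bar> < \<bar>c i \<bullet> a\<bar>"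
    proof (rule order_tendstoD)
      show "((\<lambda>\<epsilon>. \<epsilon> * \<bar>c i \<bullet> b\<bar>) \<longlongrightarrow> 0 * \<bar>c i \<bullet> b\<bar>) (at_right 0)"
        by (intro tendsto_intros)
      show "0 * \<bar>c i \<bullet> b\<bar> < \<bar>c i \<bullet> a\<bar>"
        using s False by (auto simp: sgn_real_def split: if_splits)
    qed
    then show ?thesis
      by eventually_elim (use s False in \<open>auto simp: sgn_real_def split: if_splits\<close>)
  qed simp
  then have "\<forall>\<^sub>F \<epsilon> in at_right (0::real).
      \<forall>i. \<bar>c i \<bullet> a - \<epsilon> * (c i \<bullet> b)\<bar> = \<bar>c i \<bullet> a\<bar> - \<epsilon> * \<bar>c i \<bullet> b\<bar>"
    by (rule eventually_all_finite)
  with eventually_at_right_less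
  have "\<forall>\<^sub>F \<epsilon> in at_right (0::real). 0 < \<epsilon> \<and>
      (\<forall>i. \<bar>c i \<bullet> a - \<epsilon> * (c i \<bullet> b)\<bar> = \<bar>c i \<bullet> a\<bar> - \<epsilon> * \<bar>c i \<bullet> b\<bar>)"
    by (rule eventually_conj)
  then obtain \<epsilon> :: real where \<epsilon>: "0 < \<epsilon>"
    "\<And>i. \<bar>c i \<bullet> a - \<epsilon> * (c i \<bullet> b)\<bar> = \<bar>c i \<bullet> a\<bar> - \<epsilon> * \<bar>c i \<bullet> b\<bar>"
    using eventually_happens'[OF trivial_limit_at_right_real] by blast
  have "abs_sum c (a - \<epsilon> *\<^sub>R b) = abs_sum c a - \<epsilon> * abs_sum c b"
    by (simp add: abs_sum_def inner_diff_right \<epsilon> sum_subtractf sum_distrib_left)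
  with p(1)[of "a - \<epsilon> *\<^sub>R b"] p(2) have "\<epsilon> * abs_sum c b \<le> \<epsilon> * (p \<bullet> b)"
    by (simp add: inner_diff_right)
  with \<epsilon>(1) p(1)[of b] show "p \<in> subgradients (abs_sum c) b"
    by (auto simp: subgradients_abs_sum_iff p(1) intro: antisym)
qed

text \<open>
  Two points with the same sign vector are faces of each other, and there are finitely many sign
  vectors. Here \<open>rep s\<close> picks a point with sign vector \<open>s\<close>.
\<close>

lemma finite_range_subgradients: "finite (range (subgradients (abs_sum c)))"
proof -
  define sg where "sg a = (\<lambda>i. sgn (c i \<bullet> a))" for a
  define rep where "rep s = (SOME a. sg a = s)" for s
  have rep: "sg (rep (sg a)) = sg a" for a
    unfolding rep_def by (rule someI[where x = a]) simp
  have eq: "subgradients (abs_sum c) a = subgradients (abs_sum c) (rep (sg a))" for a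
    using fun_cong[OF rep[of a]] by (intro equalityI subgradients_face) (simp_all add: sg_def)
  have "sgn r \<in> {-1, 0, 1}" for r :: real
    by (simp add: sgn_if)
  then have "range sg \<subseteq> (UNIV :: 'b set) \<rightarrow>\<^sub>E {-1, 0, 1}"
    unfolding sg_def by blast
  then have "finite (range sg)"
    by (rule finite_subset) (auto intro: finite_PiE)
  moreover have "range (subgradients (abs_sum c))
      \<subseteq> (\<lambda>s. subgradients (abs_sum c) (rep s)) ` range sg"
    using eq by blast
  ultimately show ?thesis
    by (meson finite_imageI finite_subset)
qed

text \<open>
  If \<open>p\<close> is a subgradient anywhere, the convex function \<open>F z - p \<bullet> z\<close> is nonnegative, and the points
  with subgradient \<open>p\<close> are its zeros.
\<close>

lemma convex_same_subgradient: "convex {a. p \<in> subgradients (abs_sum c) a}"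
proof (cases "\<forall>z. p \<bullet> z \<le> abs_sum c z")
  case True
  show ?thesis
  proof (rule convexI, clarsimp)
    fix x y :: 'a and \<alpha> \<beta> :: real
    assume "p \<in> subgradients (abs_sum c) x" "p \<in> subgradients (abs_sum c) y"
      and \<alpha>\<beta>: "0 \<le> \<alpha>" "0 \<le> \<beta>" "\<alpha> + \<beta> = 1"
    then have "p \<bullet> (\<alpha> *\<^sub>R x + \<beta> *\<^sub>R y) = abs_sum c (\<alpha> *\<^sub>R x) + abs_sum c (\<beta> *\<^sub>R y)"
      by (simp add: subgradients_abs_sum_iff inner_add_right abs_sum_scale)
    then have "abs_sum c (\<alpha> *\<^sub>R x + \<beta> *\<^sub>R y) \<le> p \<bullet> (\<alpha> *\<^sub>R x + \<beta> *\<^sub>R y)"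
      by (metis abs_sum_add)
    with True show "p \<in> subgradients (abs_sum c) (\<alpha> *\<^sub>R x + \<beta> *\<^sub>R y)"
      by (simp add: subgradients_abs_sum_iff antisym)
  qed
next
  case False
  then have "{a. p \<in> subgradients (abs_sum c) a} = {}"
    by (auto simp: subgradients_abs_sum_iff)
  then show ?thesis by simp
qed

lemma closed_same_subgradient: "closed {a. p \<in> subgradients (abs_sum c) a}"
  unfolding subgradients_abs_sum_iff
  by (intro closed_Collect_conj closed_Collect_const closed_Collect_eq
      continuous_intros continuous_on_abs_sum)

section \<open>Polygonal solutions of the gradient flow\<close>

definition steepest :: "('i::finite \<Rightarrow> 'a::euclidean_space) \<Rightarrow> 'a \<Rightarrow> 'a" where
  "steepest c a = closest_point (subgradients (abs_sum c) a) 0"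

lemma steepest_subgradient: "steepest c a \<in> subgradients (abs_sum c) a"
  unfolding steepest_def
  using closest_point_in_set closed_subgradients sign_gradient_subgradient by (metis empty_iff)

text \<open>
  The variational inequality that characterizes the projection of \<open>0\<close> on a closed convex set.
\<close>

lemma steepest_minimal:
  assumes "q \<in> subgradients (abs_sum c) a"
  shows "steepest c a \<bullet> steepest c a \<le> q \<bullet> steepest c a"
  using closest_point_dot[OF convex_subgradients closed_subgradients assms, of 0]
  by (simp add: steepest_def inner_diff_right inner_commute)

lemma finite_range_norm_steepest: "finite (range (\<lambda>a. norm (steepest c a)))"
proof -
  have "range (\<lambda>a. norm (steepest c a))
      = (\<lambda>S. norm (closest_point S 0)) ` range (subgradients (abs_sum c))"
    by (auto simp: steepest_def)
  then show ?thesis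
    by (simp add: finite_range_subgradients)
qed

text \<open>
  For small \<open>t\<close> the nonzero signs at \<open>a\<close> persist at \<open>x = a - t p\<close>, so the sign gradient \<open>q\<close> at \<open>x\<close>
  is also a subgradient at \<open>a\<close>. Hence the seminorm at \<open>x\<close> equals its value at \<open>a\<close> minus
  \<open>t (q \<bullet> p)\<close>, and minimality of \<open>p\<close> gives \<open>q \<bullet> p \<ge> p \<bullet> p\<close>: the decrease is at least what makes
  \<open>p\<close> a subgradient at \<open>x\<close>.
\<close>

lemma steepest_persists:
  "\<exists>\<delta>>0. \<forall>t\<in>{0..\<delta>}. steepest c a \<in> subgradients (abs_sum c) (a - t *\<^sub>R steepest c a)"
proof -
  define p where "p = steepest c a"
  have "\<forall>\<^sub>F t in nhds (0::real). c i \<bullet> a \<noteq> 0 \<longrightarrow> sgn (c i \<bullet> (a - t *\<^sub>R p)) = sgn (c i \<bullet> a)" for i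
  proof -
    have lim: "((\<lambda>t. c i \<bullet> (a - t *\<^sub>R p)) \<longlongrightarrow> c i \<bullet> (a - 0 *\<^sub>R p)) (nhds (0::real))"
      by (intro tendsto_intros filterlim_ident)
    consider "c i \<bullet> a = 0" | "c i \<bullet> a > 0" | "c i \<bullet> a < 0" by linarith
    then show ?thesis
    proof cases
      case 2
      then have "\<forall>\<^sub>F t in nhds (0::real). c i \<bullet> (a - t *\<^sub>R p) > 0"
        using order_tendstoD(1)[OF lim, of 0] by simp
      then show ?thesis by eventually_elim (use 2 in simp)
    next
      case 3
      then have "\<forall>\<^sub>F t in nhds (0::real). c i \<bullet> (a - t *\<^sub>R p) < 0"
        using order_tendstoD(2)[OF lim, of 0] by simp
      then show ?thesis by eventually_elim (use 3 in simp)
    qed simp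
  qed
  then have "\<forall>\<^sub>F t in nhds (0::real). \<forall>i. c i \<bullet> a \<noteq> 0 \<longrightarrow> sgn (c i \<bullet> (a - t *\<^sub>R p)) = sgn (c i \<bullet> a)"
    by (rule eventually_all_finite)
  then obtain d where d: "d > 0" "\<And>t i. \<bar>t\<bar> < d \<Longrightarrow> c i \<bullet> a \<noteq> 0 \<Longrightarrow>
      sgn (c i \<bullet> (a - t *\<^sub>R p)) = sgn (c i \<bullet> a)"
    unfolding eventually_nhds_metric by (auto simp: dist_real_def)
  have "p \<in> subgradients (abs_sum c) (a - t *\<^sub>R p)" if t: "t \<in> {0..d/2}" for t
  proof -
    define q where "q = sign_gradient c (a - t *\<^sub>R p)"
    have "q \<in> subgradients (abs_sum c) a"
      unfolding q_def
      using t d by (intro subsetD[OF subgradients_face sign_gradient_subgradient]) auto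
    then have qa: "q \<bullet> a = abs_sum c a" and "p \<bullet> p \<le> q \<bullet> p"
      by (auto simp: subgradients_abs_sum_iff p_def steepest_minimal)
    then have "t * (p \<bullet> p) \<le> t * (q \<bullet> p)"
      using t by (intro mult_left_mono) auto
    moreover have "abs_sum c (a - t *\<^sub>R p) = abs_sum c a - t * (q \<bullet> p)"
      using sign_gradient_inner_self[of c "a - t *\<^sub>R p", folded q_def] qa
      by (simp add: inner_diff_right)
    moreover have p: "p \<bullet> z \<le> abs_sum c z" "p \<bullet> a = abs_sum c a" for z
      using steepest_subgradient[of c a] by (auto simp: subgradients_abs_sum_iff p_def)
    ultimately have "abs_sum c (a - t *\<^sub>R p) \<le> p \<bullet> (a - t *\<^sub>R p)"
      by (simp add: inner_diff_right)
    then show ?thesis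
      using p(1) by (simp add: subgradients_abs_sum_iff antisym)
  qed
  then show ?thesis
    using d(1) unfolding p_def by (intro exI[of _ "d/2"]) auto
qed

text \<open>
  In a trajectory with finitely many corners, each segment and the final ray has minus a fixed
  subgradient as velocity. Induction over the segments replaces differential inequalities.
\<close>

inductive polygonal_flow :: "('a::euclidean_space \<Rightarrow> real) \<Rightarrow> (real \<Rightarrow> 'a) \<Rightarrow> bool"
  for F :: "'a \<Rightarrow> real" where
  ray: "(\<And>t. t \<ge> 0 \<Longrightarrow> p \<in> subgradients F (a - t *\<^sub>R p)) \<Longrightarrow> polygonal_flow F (\<lambda>t. a - t *\<^sub>R p)"
| bend: "T \<ge> 0 \<Longrightarrow> (\<And>t. t \<in> {0..T} \<Longrightarrow> p \<in> subgradients F (a - t *\<^sub>R p)) \<Longrightarrow>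
    polygonal_flow F u \<Longrightarrow> u 0 = a - T *\<^sub>R p \<Longrightarrow>
    polygonal_flow F (\<lambda>t. if t \<le> T then a - t *\<^sub>R p else u (t - T))"

text \<open>
  Follow the steepest direction \<open>p\<close> up to the last time \<open>T\<close> at which it is still a subgradient, and
  call that point \<open>b\<close>. By persistence the subgradient of minimal norm at \<open>b\<close> differs from \<open>p\<close>. As \<open>p\<close>
  competes with it at \<open>b\<close>, its norm is strictly smaller. The induction is on the number of minimal
  norms below the current one.
\<close>

lemma polygonal_flow_exists: "\<exists>u. u 0 = a \<and> polygonal_flow (abs_sum c) u"
proof (induction "card {r \<in> range (\<lambda>a. norm (steepest c a)). r < norm (steepest c a)}"
    arbitrary: a rule: less_induct)
  case less
  define p where "p = steepest c a"
  \<comment> \<open>By convexity the times at which \<open>p\<close> is a subgradient form an interval from \<open>0\<close>, by continuity a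
    closed one.\<close>
  define J where "J = {t. 0 \<le> t \<and> p \<in> subgradients (abs_sum c) (a - t *\<^sub>R p)}"
  show ?case
  proof (cases "J = {0..}")
    case True
    then have "p \<in> subgradients (abs_sum c) (a - t *\<^sub>R p)" if "t \<ge> 0" for t
      using that by (auto simp: J_def)
    from ray[OF this] show ?thesis
      by (intro exI[of _ "\<lambda>t. a - t *\<^sub>R p"]) simp
  next
    case False
    have downward: "s \<in> J" if "t \<in> J" "0 \<le> s" "s \<le> t" for s t
    proof (cases "t = 0")
      case False
      have eq: "a - s *\<^sub>R p = (1 - s/t) *\<^sub>R (a - 0 *\<^sub>R p) + (s/t) *\<^sub>R (a - t *\<^sub>R p)"
        using False by (simp add: algebra_simps)
      have "a - s *\<^sub>R p \<in> {a. p \<in> subgradients (abs_sum c) a}"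
        unfolding eq
        using that False steepest_subgradient[of c a]
        by (intro convexD[OF convex_same_subgradient]) (auto simp: J_def p_def)
      with that show ?thesis by (simp add: J_def)
    qed (use that in auto)
    from False obtain t\<^sub>0 where "t\<^sub>0 \<ge> 0" "t\<^sub>0 \<notin> J"
      by (auto simp: J_def)
    then have "t \<le> t\<^sub>0" if "t \<in> J" for t
      using downward[OF that] by force
    then have "bdd_above J" by (auto simp: bdd_above_def)
    moreover have "closed J"
    proof -
      have "J = {0..} \<inter> (\<lambda>t. a - t *\<^sub>R p) -` {a. p \<in> subgradients (abs_sum c) a}"
        by (auto simp: J_def)
      then show ?thesis
        by (simp only:) (intro closed_Int closed_atLeast closed_vimage closed_same_subgradient
            continuous_intros)
    qed
    moreover have "0 \<in> J"
      by (simp add: J_def p_def steepest_subgradient)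
    ultimately have Sup_J: "Sup J \<in> J"
      by (metis closed_contains_Sup empty_iff)
    define T where "T = Sup J"
    define b where "b = a - T *\<^sub>R p"
    have T_J: "T \<in> J" using Sup_J by (simp add: T_def)
    then have T: "T \<ge> 0" "p \<in> subgradients (abs_sum c) b"
      by (simp_all add: J_def b_def)
    have upto: "{0..T} \<subseteq> J"
      using downward[OF T_J] by auto
    have "steepest c b \<noteq> p"
    proof
      assume eq: "steepest c b = p"
      obtain \<delta> where "\<delta> > 0" "p \<in> subgradients (abs_sum c) (b - \<delta> *\<^sub>R p)"
        using steepest_persists[of c b] unfolding eq by auto
      then have "T + \<delta> \<in> J"
        using T(1) by (simp add: J_def b_def algebra_simps)
      then show False
        using cSup_upper[OF _ \<open>bdd_above J\<close>, of "T + \<delta>"] \<open>\<delta> > 0\<close> by (simp add: T_def)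
    qed
    then have "0 < (p - steepest c b) \<bullet> (p - steepest c b)" by simp
    then have "(norm (steepest c b))\<^sup>2 < (norm p)\<^sup>2"
      using steepest_minimal[OF T(2)]
      by (simp add: power2_norm_eq_inner inner_diff_left inner_diff_right inner_commute)
    then have slower: "norm (steepest c b) < norm (steepest c a)"
      unfolding p_def using norm_ge_zero power2_less_imp_less by blast
    have "card {r \<in> range (\<lambda>a. norm (steepest c a)). r < norm (steepest c b)}
        < card {r \<in> range (\<lambda>a. norm (steepest c a)). r < norm (steepest c a)}"
    proof (rule psubset_card_mono)
      show "finite {r \<in> range (\<lambda>a. norm (steepest c a)). r < norm (steepest c a)}"
        using finite_range_norm_steepest[of c] by simp
      have "norm (steepest c b) \<in> {r \<in> range (\<lambda>a. norm (steepest c a)). r < norm (steepest c a)}"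
        using slower by simp
      moreover have "norm (steepest c b) \<notin> {r \<in> range (\<lambda>a. norm (steepest c a)). r < norm (steepest c b)}"
        by simp
      ultimately show "{r \<in> range (\<lambda>a. norm (steepest c a)). r < norm (steepest c b)}
          \<subset> {r \<in> range (\<lambda>a. norm (steepest c a)). r < norm (steepest c a)}"
        using slower by fastforce
    qed
    from less.hyps[OF this] obtain u where u: "u 0 = b" "polygonal_flow (abs_sum c) u"
      by blast
    have "p \<in> subgradients (abs_sum c) (a - t *\<^sub>R p)" if "t \<in> {0..T}" for t
      using upto that by (auto simp: J_def)
    from bend[OF T(1) this u(2)] u(1)
    have "polygonal_flow (abs_sum c) (\<lambda>t. if t \<le> T then a - t *\<^sub>R p else u (t - T))"
      by (simp add: b_def)
    then show ?thesis
      using T(1) by (intro exI[of _ "\<lambda>t. if t \<le> T then a - t *\<^sub>R p else u (t - T)"]) simp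
  qed
qed

definition gradient_flow :: "('a::euclidean_space \<Rightarrow> real) \<Rightarrow> (real \<Rightarrow> 'a) \<Rightarrow> bool" where
  "gradient_flow F u \<longleftrightarrow>
     (\<exists>g. (\<forall>T>0. W11_derivative T u g) \<and>
          (AE t in lborel. t > 0 \<longrightarrow> - g t \<in> subgradients F (u t)))"

lemma W11_derivative_line: "W11_derivative T (\<lambda>t. a - t *\<^sub>R p) (\<lambda>t. - p)"
  unfolding W11_derivative_def
proof (intro conjI ballI)
  show "set_integrable lborel {0..T} (\<lambda>t. - p)"
    unfolding set_integrable_def
    by (intro integrable_scaleR_left integrable_real_indicator) (auto simp: emeasure_lborel_Icc_eq)
  show "a - t *\<^sub>R p = a - 0 *\<^sub>R p + (LINT s:{0..t}|lborel. - p)" if "t \<in> {0..T}" for t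
    using that by (simp add: set_lebesgue_integral_def measure_def)
qed

lemma set_integrable_shift:
  fixes g :: "real \<Rightarrow> 'a::euclidean_space"
  assumes "set_integrable lborel {0..t - T} g"
  shows "set_integrable lborel {T..t} (\<lambda>s. g (s - T))"
    and "(LINT s:{T..t}|lborel. g (s - T)) = (LINT s:{0..t - T}|lborel. g s)"
proof -
  define f where "f s = indicator {0..t - T} s *\<^sub>R g s" for s
  have shift: "indicator {T..t} s *\<^sub>R g (s - T) = f (- T + 1 * s)" for s
    by (auto simp: f_def indicator_def algebra_simps)
  have f: "integrable lborel f"
    using assms unfolding set_integrable_def f_def .
  show "set_integrable lborel {T..t} (\<lambda>s. g (s - T))"
    unfolding set_integrable_def shift
    by (rule lborel_integrable_real_affine[OF f]) simp
  show "(LINT s:{T..t}|lborel. g (s - T)) = (LINT s:{0..t - T}|lborel. g s)"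
    unfolding set_lebesgue_integral_def shift
    using lborel_integral_real_affine[of 1 f "- T"] by (simp add: f_def)
qed

lemma W11_derivative_increment:
  assumes W: "\<And>T. T > 0 \<Longrightarrow> W11_derivative T u g" and "0 \<le> r"
  shows "set_integrable lborel {r..t} g"
    and "r \<le> t \<Longrightarrow> u t - u r = (LINT s:{r..t}|lborel. g s)"
proof -
  have primitive: "u s = u 0 + (LINT s:{0..s}|lborel. g s)" if "s \<ge> 0" for s
  proof -
    have "W11_derivative (s + 1) u g" "s \<in> {0..s + 1}"
      using that by (auto intro: W)
    then show ?thesis unfolding W11_derivative_def by blast
  qed
  have "W11_derivative (max t 1) u g"
    by (rule W) simp
  then have "set_integrable lborel {0..max t 1} g"
    by (simp add: W11_derivative_def)
  then have int: "set_integrable lborel A g" if "A \<subseteq> {0..t}" "A \<in> sets lborel" for A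
    by (rule set_integrable_subset) (use that in force)+
  show int_rt: "set_integrable lborel {r..t} g"
    using \<open>0 \<le> r\<close> by (intro int) auto
  assume "r \<le> t"
  then have "{0..t} = {0..r} \<union> {r..t}" using \<open>0 \<le> r\<close> by auto
  moreover have "AE s in lborel. \<not> (s \<in> {0..r} \<and> s \<in> {r..t})"
    using AE_lborel_singleton[of r] by eventually_elim auto
  ultimately have "(LINT s:{0..t}|lborel. g s)
      = (LINT s:{0..r}|lborel. g s) + (LINT s:{r..t}|lborel. g s)"
    using \<open>r \<le> t\<close> by (simp add: set_integral_Un_AE int int_rt)
  then show "u t - u r = (LINT s:{r..t}|lborel. g s)"
    using primitive[of t] primitive[of r] \<open>0 \<le> r\<close> \<open>r \<le> t\<close> by simp
qed

lemma W11_derivative_concat: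
  fixes u v :: "real \<Rightarrow> 'a::euclidean_space"
  assumes u: "\<And>S. S > 0 \<Longrightarrow> W11_derivative S u g" and v: "\<And>S. S > 0 \<Longrightarrow> W11_derivative S v h"
    and "0 \<le> T" "v 0 = u T" "0 < S"
  shows "W11_derivative S (\<lambda>t. if t \<le> T then u t else v (t - T))
    (\<lambda>t. if t \<le> T then g t else h (t - T))" (is "W11_derivative S ?w ?f")
proof -
  note g = W11_derivative_increment[OF u order_refl] and h = W11_derivative_increment[OF v order_refl]
  have f1: "set_integrable lborel {0..t} ?f" "(LINT s:{0..t}|lborel. ?f s) = (LINT s:{0..t}|lborel. g s)"
    if "t \<le> T" for t
  proof -
    show "set_integrable lborel {0..t} ?f"
      using g(1)[of t] that by (subst set_integrable_cong[where f' = g]) auto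
    show "(LINT s:{0..t}|lborel. ?f s) = (LINT s:{0..t}|lborel. g s)"
      using that by (intro set_lebesgue_integral_cong) auto
  qed
  have f2: "set_integrable lborel {T<..t} ?f"
    "(LINT s:{T<..t}|lborel. ?f s) = (LINT s:{0..t - T}|lborel. h s)" for t
  proof -
    have hs: "set_integrable lborel {T..t} (\<lambda>s. h (s - T))"
      "(LINT s:{T..t}|lborel. h (s - T)) = (LINT s:{0..t - T}|lborel. h s)"
      using set_integrable_shift[OF h(1)] by auto
    have "set_integrable lborel {T<..t} (\<lambda>s. h (s - T))"
      by (rule set_integrable_subset[OF hs(1)]) auto
    then show "set_integrable lborel {T<..t} ?f"
      by (subst set_integrable_cong[where f' = "\<lambda>s. h (s - T)"]) auto
    have "(LINT s:{T<..t}|lborel. ?f s) = (LINT s:{T<..t}|lborel. h (s - T))"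
      by (intro set_lebesgue_integral_cong) auto
    also have "\<dots> = (LINT s:{T..t}|lborel. h (s - T))"
    proof -
      have "AE s in lborel. indicator {T<..t} s *\<^sub>R h (s - T) = indicator {T..t} s *\<^sub>R h (s - T)"
        using AE_lborel_singleton[of T] by eventually_elim (auto simp: indicator_def)
      moreover have "(\<lambda>s. indicator {T<..t} s *\<^sub>R h (s - T)) \<in> borel_measurable lborel"
        "(\<lambda>s. indicator {T..t} s *\<^sub>R h (s - T)) \<in> borel_measurable lborel"
        using \<open>set_integrable lborel {T<..t} (\<lambda>s. h (s - T))\<close> hs(1)
        by (auto simp: set_integrable_def dest: borel_measurable_integrable)
      ultimately show ?thesis
        unfolding set_lebesgue_integral_def by (intro integral_cong_AE) auto
    qed
    finally show "(LINT s:{T<..t}|lborel. ?f s) = (LINT s:{0..t - T}|lborel. h s)"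
      using hs(2) by simp
  qed
  have split: "{0..t} = {0..T} \<union> {T<..t}" if "t \<ge> T" for t
    using that \<open>0 \<le> T\<close> by auto
  show ?thesis
    unfolding W11_derivative_def
  proof (intro conjI ballI)
    show "set_integrable lborel {0..S} ?f"
    proof (cases "S \<le> T")
      case False
      then show ?thesis
        using split[of S] set_integrable_Un[OF f1(1) f2(1), of T] by simp
    qed (rule f1(1))
    fix t assume t: "t \<in> {0..S}"
    show "?w t = ?w 0 + (LINT s:{0..t}|lborel. ?f s)"
    proof (cases "t \<le> T")
      case True
      then show ?thesis using t g(2)[of t] f1(2)[OF True] \<open>0 \<le> T\<close> by (simp add: algebra_simps)
    next
      case False
      have "(LINT s:{0..t}|lborel. ?f s)
          = (LINT s:{0..T}|lborel. ?f s) + (LINT s:{T<..t}|lborel. ?f s)"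
        using False f1(1)[of T] f2(1)[of t] by (subst split) (auto intro!: set_integral_Un)
      also have "\<dots> = (LINT s:{0..T}|lborel. g s) + (LINT s:{0..t - T}|lborel. h s)"
        using f1(2)[of T] f2(2)[of t] by simp
      finally show ?thesis
        using False g(2)[of T] h(2)[of "t - T"] \<open>0 \<le> T\<close> \<open>v 0 = u T\<close>
        by (simp add: algebra_simps)
    qed
  qed
qed

lemma polygonal_flow_gradient_flow:
  assumes "polygonal_flow F u"
  shows "gradient_flow F u"
proof -
  have "\<exists>g. (\<forall>S>0. W11_derivative S u g) \<and> (\<forall>t\<ge>0. - g t \<in> subgradients F (u t))"
    using assms
  proof induction
    case (ray p a)
    then show ?case
      by (intro exI[of _ "\<lambda>t. - p"]) (simp add: W11_derivative_line)
  next
    case (bend T p a u)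
    then obtain g where g: "\<And>S. S > 0 \<Longrightarrow> W11_derivative S u g"
      "\<And>t. t \<ge> 0 \<Longrightarrow> - g t \<in> subgradients F (u t)"
      by blast
    let ?f = "\<lambda>t. if t \<le> T then - p else g (t - T)"
    have "W11_derivative S (\<lambda>t. if t \<le> T then a - t *\<^sub>R p else u (t - T)) ?f" if "S > 0" for S
      using bend.hyps that by (intro W11_derivative_concat W11_derivative_line g(1)) auto
    moreover have "- ?f t \<in> subgradients F (if t \<le> T then a - t *\<^sub>R p else u (t - T))"
      if "t \<ge> 0" for t
      using bend.hyps(2)[of t] g(2)[of "t - T"] that by auto
    ultimately show ?case by blast
  qed
  then obtain g where "\<forall>S>0. W11_derivative S u g" "\<forall>t\<ge>0. - g t \<in> subgradients F (u t)"
    by blast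
  then show ?thesis
    unfolding gradient_flow_def by (intro exI[of _ g]) auto
qed

text \<open>
  On a segment with velocity \<open>- p\<close> from \<open>a\<close> to \<open>z + m\<close> at time \<open>t\<close>, the decay needs no
  differentiation: \<open>norm (a - m) * norm z \<ge> (a - m) \<bullet> z = (norm z)\<^sup>2 + t * (p \<bullet> z)\<close>, and
  \<open>p \<bullet> z \<ge> F z \<ge> lam * norm z\<close>, so \<open>norm z\<close> can be cancelled unless it is zero.
\<close>

lemma polygonal_flow_decay:
  assumes "polygonal_flow (abs_sum c) u"
    and lam: "lam > 0" "\<And>z. z \<bullet> e = 0 \<Longrightarrow> lam * norm z \<le> abs_sum c z"
    and null: "abs_sum c e = 0" "abs_sum c m = 0"
    and "(u 0 - m) \<bullet> e = 0" "t \<ge> 0"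
  shows "norm (u t - m) \<le> max (norm (u 0 - m) - lam * t) 0"
proof -
  have segment: "norm (a - t *\<^sub>R p - m) \<le> max (norm (a - m) - lam * t) 0"
    "(a - t *\<^sub>R p - m) \<bullet> e = 0"
    if "p \<in> subgradients (abs_sum c) (a - t *\<^sub>R p)" "(a - m) \<bullet> e = 0" "t \<ge> 0" for a p :: 'a and t
  proof -
    define z where "z = a - t *\<^sub>R p - m"
    note pe = subgradient_orthogonal_null[OF that(1) null(1)]
      and pm = subgradient_orthogonal_null[OF that(1) null(2)]
    show ze: "(a - t *\<^sub>R p - m) \<bullet> e = 0"
      using that(2) pe by (simp add: inner_diff_left)
    have "lam * norm z \<le> abs_sum c z"
      using lam(2)[of z] ze by (simp add: z_def)
    also have "abs_sum c z \<le> abs_sum c (a - t *\<^sub>R p)"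
      using abs_sum_add[of c "a - t *\<^sub>R p" "(-1) *\<^sub>R m"] null(2) abs_sum_scale[of c "-1" m]
      by (simp add: z_def)
    also have "\<dots> = p \<bullet> z"
      using that(1) pm by (simp add: z_def subgradients_abs_sum_iff inner_diff_right)
    finally have "t * (lam * norm z) \<le> t * (p \<bullet> z)"
      using that(3) by (rule mult_left_mono)
    moreover have "(a - m) \<bullet> z = z \<bullet> z + t * (p \<bullet> z)"
      by (simp add: z_def inner_diff_left algebra_simps)
    moreover have "(a - m) \<bullet> z \<le> norm (a - m) * norm z"
      by (rule norm_cauchy_schwarz)
    ultimately have "(norm z + lam * t) * norm z \<le> norm (a - m) * norm z"
      by (simp add: dot_square_norm power2_eq_square algebra_simps)
    then have "z = 0 \<or> norm z + lam * t \<le> norm (a - m)"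
      by (metis mult_le_cancel_right_pos zero_less_norm_iff)
    then show "norm (a - t *\<^sub>R p - m) \<le> max (norm (a - m) - lam * t) 0"
      unfolding z_def[symmetric] by auto
  qed
  show ?thesis
    using assms(1) assms(6-)
  proof (induction arbitrary: t)
    case (ray p a)
    then show ?case using segment(1)[of p a t] by simp
  next
    case (bend T p a u)
    show ?case
    proof (cases "t \<le> T")
      case True
      with bend show ?thesis using segment(1)[of p a t] by simp
    next
      case False
      have a: "(a - m) \<bullet> e = 0" using bend by simp
      have T: "norm (u 0 - m) \<le> max (norm (a - m) - lam * T) 0" "(u 0 - m) \<bullet> e = 0"
        using segment[OF bend.hyps(2)[of T] a] bend.hyps by auto
      have "norm (u (t - T) - m) \<le> max (norm (u 0 - m) - lam * (t - T)) 0"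
        using False T(2) bend.IH by simp
      also have "\<dots> \<le> max (norm (a - m) - lam * t) 0"
      proof -
        have "0 \<le> lam * (t - T)" using lam(1) False by simp
        then show ?thesis using T(1) by (auto simp: algebra_simps)
      qed
      finally show ?thesis using False bend.hyps(1) by simp
    qed
  qed
qed

section \<open>Uniqueness of the gradient flow\<close>

text \<open>
  Subdividing \<open>[0, t]\<close> into \<open>N\<close> equal parts bounds the growth of \<open>h\<close> by \<open>C * t\<^sup>2 / N\<close>.
\<close>

lemma quadratic_increments_antimono:
  fixes h :: "real \<Rightarrow> real"
  assumes step: "\<And>r s. 0 \<le> r \<Longrightarrow> r \<le> s \<Longrightarrow> h s - h r \<le> C * (s - r)\<^sup>2" and "t \<ge> 0"
  shows "h t \<le> h 0"
proof -
  have bound: "h t - h 0 \<le> C * t\<^sup>2 * inverse (real (Suc n))" for n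
  proof -
    define N where "N = Suc n"
    have "h t - h 0 = (\<Sum>k<N. h (t * real (Suc k) / real N) - h (t * real k / real N))"
      using sum_lessThan_telescope[of "\<lambda>k. h (t * real k / real N)" N] by (simp add: N_def)
    also have "\<dots> \<le> (\<Sum>k<N. C * (t / real N)\<^sup>2)"
    proof (rule sum_mono)
      fix k
      have "t * real (Suc k) / real N - t * real k / real N = t / real N"
        by (simp add: add_divide_distrib distrib_left)
      with step[of "t * real k / real N" "t * real (Suc k) / real N"] \<open>t \<ge> 0\<close>
      show "h (t * real (Suc k) / real N) - h (t * real k / real N) \<le> C * (t / real N)\<^sup>2"
        by (simp add: divide_right_mono mult_left_mono)
    qed
    also have "\<dots> = C * t\<^sup>2 * inverse (real N)"
      by (simp add: N_def power2_eq_square divide_inverse)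
    finally show ?thesis by (simp add: N_def)
  qed
  have "(\<lambda>n. C * t\<^sup>2 * inverse (real (Suc n))) \<longlonglongrightarrow> C * t\<^sup>2 * 0"
    by (intro tendsto_intros LIMSEQ_inverse_real_of_nat)
  then have "h t - h 0 \<le> C * t\<^sup>2 * 0"
    using bound by (intro LIMSEQ_le_const) auto
  then show ?thesis by simp
qed

text \<open>
  For the difference \<open>z\<close> of two solutions, \<open>d s \<bullet> z s \<le> 0\<close> almost everywhere for its derivative \<open>d\<close>,
  since the subdifferential is monotone. Subgradients are bounded, so \<open>z\<close> is Lipschitz. In
  \<open>(norm (z t))\<^sup>2 - (norm (z r))\<^sup>2 = (z t - z r) \<bullet> (z t + z r)\<close>, which is the integral of
  \<open>d s \<bullet> (z t + z r)\<close>, replacing \<open>z t + z r\<close> by \<open>2 z s\<close> costs only \<open>O((t - r)\<^sup>2)\<close>. This avoids the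
  product rule for absolutely continuous functions.
\<close>

lemma gradient_flow_unique:
  assumes u: "gradient_flow (abs_sum c) u" and v: "gradient_flow (abs_sum c) v"
    and "u 0 = v 0" "t \<ge> 0"
  shows "u t = v t"
proof -
  obtain g where g: "\<And>T. T > 0 \<Longrightarrow> W11_derivative T u g"
    "AE t in lborel. t > 0 \<longrightarrow> - g t \<in> subgradients (abs_sum c) (u t)"
    using u by (auto simp: gradient_flow_def)
  obtain h where h: "\<And>T. T > 0 \<Longrightarrow> W11_derivative T v h"
    "AE t in lborel. t > 0 \<longrightarrow> - h t \<in> subgradients (abs_sum c) (v t)"
    using v by (auto simp: gradient_flow_def)
  define z where "z t = u t - v t" for t
  define d where "d t = g t - h t" for t
  define L where "L = 2 * (\<Sum>i\<in>UNIV. norm (c i))"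
  have L: "L \<ge> 0" by (simp add: L_def sum_nonneg)
  have ae: "AE s in lborel. s > 0 \<longrightarrow> norm (d s) \<le> L \<and> d s \<bullet> z s \<le> 0"
    using g(2) h(2)
  proof eventually_elim
    case (elim s)
    show ?case
    proof
      assume "s > 0"
      then have gs: "- g s \<in> subgradients (abs_sum c) (u s)"
        and hs: "- h s \<in> subgradients (abs_sum c) (v s)"
        using elim by auto
      have "norm (d s) \<le> norm (- g s) + norm (- h s)"
        by (simp add: d_def norm_triangle_ineq4)
      also have "\<dots> \<le> L"
        using norm_subgradient_le[OF gs] norm_subgradient_le[OF hs] by (simp add: L_def)
      finally have "norm (d s) \<le> L" .
      moreover have "abs_sum c (u s) + (- g s) \<bullet> (v s - u s) \<le> abs_sum c (v s)"
        "abs_sum c (v s) + (- h s) \<bullet> (u s - v s) \<le> abs_sum c (u s)"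
        using gs hs by (auto simp: subgradients_def)
      then have "d s \<bullet> z s \<le> 0"
        by (simp add: d_def z_def inner_diff_left inner_diff_right)
      ultimately show "norm (d s) \<le> L \<and> d s \<bullet> z s \<le> 0" ..
    qed
  qed
  have incr_z: "z t - z r = (u t - u r) - (v t - v r)" for r t
    by (simp add: z_def)
  have incr: "set_integrable lborel {r..t} d" "z t - z r = (LINT s:{r..t}|lborel. d s)"
    if "0 \<le> r" "r \<le> t" for r t
    using W11_derivative_increment[OF g(1) that(1)] W11_derivative_increment[OF h(1) that(1)] that(2)
    by (auto simp: d_def[abs_def] incr_z)
  have const: "set_integrable lborel {r..t} (\<lambda>s. k)" "r \<le> t \<Longrightarrow> (LINT s:{r..t}|lborel. k) = k * (t - r)"
    for r t k :: real
    unfolding set_integrable_def set_lebesgue_integral_def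
    by (auto intro!: integrable_mult_left integrable_real_indicator simp: emeasure_lborel_Icc_eq)
  have lip: "norm (z t - z r) \<le> L * (t - r)" if "0 \<le> r" "r \<le> t" for r t
  proof -
    have "norm (z t - z r) \<le> (LINT s:{r..t}|lborel. norm (d s))"
      unfolding incr(2)[OF that] by (rule set_integral_norm_bound[OF incr(1)[OF that]])
    also have "\<dots> \<le> (LINT s:{r..t}|lborel. L)"
    proof (rule set_integral_mono_AE)
      show "set_integrable lborel {r..t} (\<lambda>s. norm (d s))"
        by (rule set_integrable_norm[OF incr(1)[OF that]])
      show "AE s\<in>{r..t} in lborel. norm (d s) \<le> L"
        using ae AE_lborel_singleton[of 0] by eventually_elim (use that in auto)
    qed (rule const)
    finally show ?thesis using const(2)[OF that(2)] by simp
  qed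
  have "(norm (z t))\<^sup>2 - (norm (z r))\<^sup>2 \<le> (2 * L * L) * (t - r)\<^sup>2" if "0 \<le> r" "r \<le> t" for r t
  proof -
    define y where "y = z t + z r"
    have "(norm (z t))\<^sup>2 - (norm (z r))\<^sup>2 = (z t - z r) \<bullet> y"
      by (simp add: y_def power2_norm_eq_inner inner_diff_left inner_diff_right inner_add_right inner_commute)
    also have "\<dots> = (LINT s:{r..t}|lborel. d s \<bullet> y)"
      unfolding incr(2)[OF that] set_lebesgue_integral_def
      using integral_inner_left[OF incr(1)[OF that, unfolded set_integrable_def], of y]
      by simp
    also have "\<dots> \<le> (LINT s:{r..t}|lborel. L * (2 * L * (t - r)))"
    proof (rule set_integral_mono_AE)
      show "set_integrable lborel {r..t} (\<lambda>s. d s \<bullet> y)"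
        using integrable_inner_left[OF incr(1)[OF that, unfolded set_integrable_def], of y]
        by (simp add: set_integrable_def)
      show "AE s\<in>{r..t} in lborel. d s \<bullet> y \<le> L * (2 * L * (t - r))"
        using ae AE_lborel_singleton[of 0]
      proof eventually_elim
        case (elim s)
        show ?case
        proof
          assume s: "s \<in> {r..t}"
          then have ds: "norm (d s) \<le> L" "d s \<bullet> z s \<le> 0" using elim that by auto
          have "norm (y - 2 *\<^sub>R z s) = norm ((z t - z s) - (z s - z r))"
            by (simp add: y_def algebra_simps scaleR_2)
          also have "\<dots> \<le> L * (t - s) + L * (s - r)"
            using lip[of s t] lip[of r s] s that
              norm_triangle_ineq4[of "z t - z s" "z s - z r"] by simp
          also have "\<dots> \<le> 2 * L * (t - r)"
            using L that by (simp add: algebra_simps mult_left_mono)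
          finally have y: "norm (y - 2 *\<^sub>R z s) \<le> 2 * L * (t - r)" .
          have "d s \<bullet> y \<le> d s \<bullet> (y - 2 *\<^sub>R z s)"
            using ds(2) by (simp add: inner_diff_right)
          also have "\<dots> \<le> norm (d s) * norm (y - 2 *\<^sub>R z s)"
            by (rule norm_cauchy_schwarz)
          also have "\<dots> \<le> L * (2 * L * (t - r))"
            using ds(1) y L by (intro mult_mono) auto
          finally show "d s \<bullet> y \<le> L * (2 * L * (t - r))" .
        qed
      qed
    qed (rule const)
    also have "\<dots> = (2 * L * L) * (t - r)\<^sup>2"
      using const(2)[OF that(2)] by (simp add: power2_eq_square)
    finally show ?thesis .
  qed
  from quadratic_increments_antimono[OF this \<open>t \<ge> 0\<close>] have "(norm (z t))\<^sup>2 \<le> (norm (z 0))\<^sup>2"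
    by simp
  then show ?thesis
    using \<open>u 0 = v 0\<close> by (simp add: z_def)
qed


section \<open>Total variation on a weighted graph\<close>

lemma W11_derivative_bounded_linear:
  fixes L :: "'a::euclidean_space \<Rightarrow> 'b::euclidean_space"
  assumes L: "bounded_linear L" and W: "W11_derivative T u g"
  shows "W11_derivative T (\<lambda>t. L (u t)) (\<lambda>t. L (g t))"
proof -
  have push: "set_integrable lborel A (\<lambda>t. L (g t))"
    "(LINT s:A|lborel. L (g s)) = L (LINT s:A|lborel. g s)"
    if "set_integrable lborel A g" for A
  proof -
    have "(\<lambda>s. indicator A s *\<^sub>R L (g s)) = (\<lambda>s. L (indicator A s *\<^sub>R g s))"
      using L by (simp add: linear_cmul bounded_linear.linear)
    then show "set_integrable lborel A (\<lambda>t. L (g t))"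
      "(LINT s:A|lborel. L (g s)) = L (LINT s:A|lborel. g s)"
      using that integrable_bounded_linear[OF L] integral_bounded_linear[OF L]
      by (auto simp: set_integrable_def set_lebesgue_integral_def)
  qed
  show ?thesis
    unfolding W11_derivative_def
  proof (intro conjI ballI)
    show "set_integrable lborel {0..T} (\<lambda>t. L (g t))"
      using W by (auto simp: W11_derivative_def intro: push)
    fix t assume t: "t \<in> {0..T}"
    then have "set_integrable lborel {0..t} g"
      using W by (auto simp: W11_derivative_def intro: set_integrable_subset)
    moreover have "u t = u 0 + (LINT s:{0..t}|lborel. g s)"
      using W t unfolding W11_derivative_def by blast
    ultimately show "L (u t) = L (u 0) + (LINT s:{0..t}|lborel. L (g s))"
      by (simp add: push(2) linear_add[OF bounded_linear.linear[OF L]])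
  qed
qed

text \<open>
  This is the isometry from \<open>L\<^sup>2(V(G), \<nu>\<^sub>G)\<close> to Euclidean space; \<open>unweigh\<close> is its inverse.
\<close>

definition weigh :: "('v::finite \<Rightarrow> 'v \<Rightarrow> real) \<Rightarrow> real ^ 'v \<Rightarrow> real ^ 'v" where
  "weigh w u = (\<chi> x. sqrt (deg w x) * u $ x)"

definition unweigh :: "('v::finite \<Rightarrow> 'v \<Rightarrow> real) \<Rightarrow> real ^ 'v \<Rightarrow> real ^ 'v" where
  "unweigh w a = (\<chi> x. a $ x / sqrt (deg w x))"

text \<open>
  The inner product of \<open>edge_functional w (x, y)\<close> with \<open>weigh w u\<close> is \<open>w x y * (u $ y - u $ x) / 2\<close>,
  the contribution of the ordered pair \<open>(x, y)\<close> to the total variation before the absolute value.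
\<close>

definition edge_functional :: "('v::finite \<Rightarrow> 'v \<Rightarrow> real) \<Rightarrow> 'v \<times> 'v \<Rightarrow> real ^ 'v" where
  "edge_functional w = (\<lambda>(x, y). (w x y / 2) *\<^sub>R
     (axis y (1 / sqrt (deg w y)) - axis x (1 / sqrt (deg w x))))"

lemma bounded_linear_weigh: "bounded_linear (weigh w)"
  unfolding linear_conv_bounded_linear[symmetric]
  by (auto intro!: linearI simp: weigh_def vec_eq_iff algebra_simps)

lemma bounded_linear_unweigh: "bounded_linear (unweigh w)"
  unfolding linear_conv_bounded_linear[symmetric]
  by (auto intro!: linearI simp: unweigh_def vec_eq_iff add_divide_distrib)

lemma weigh_diff: "weigh w (u - v) = weigh w u - weigh w v"
  by (simp add: weigh_def vec_eq_iff right_diff_distrib)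

context weighted_connected_graph
begin

lemma weight_nonneg: "w x y \<ge> 0"
  using weight_pos weight_zero by (metis less_eq_real_def)

lemma deg_nonneg [simp]: "deg w x \<ge> 0"
  using deg_pos less_imp_le by blast

lemma deg_nonzero [simp]: "deg w x \<noteq> 0"
  using deg_pos by (metis less_irrefl)

lemma weigh_unweigh [simp]: "weigh w (unweigh w a) = a" "unweigh w (weigh w u) = u"
  by (simp_all add: weigh_def unweigh_def vec_eq_iff)

lemma weigh_eq_0_iff: "weigh w u = 0 \<longleftrightarrow> u = 0"
  by (simp add: weigh_def vec_eq_iff)

lemma integral_nu: "(\<integral>x. f x \<partial>nu w) = (\<Sum>x\<in>UNIV. deg w x * f x)" for f :: "'v \<Rightarrow> real"
  by (simp add: nu_def lebesgue_integral_point_measure_finite)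

lemma inner_weigh: "weigh w u \<bullet> weigh w v = (\<integral>x. u $ x * v $ x \<partial>nu w)"
  unfolding integral_nu inner_vec_def
  by (intro sum.cong) (auto simp: weigh_def algebra_simps simp flip: power2_eq_square)

lemma norm_weigh: "norm (weigh w u) = L2_norm w u"
  by (simp add: L2_norm_def norm_eq_sqrt_inner inner_weigh power2_eq_square)

lemma integral_eq_inner: "(\<integral>x. u $ x \<partial>nu w) = weigh w u \<bullet> weigh w (vec 1)"
  by (simp add: inner_weigh)

lemma TV_eq_abs_sum: "TV w u = abs_sum (edge_functional w) (weigh w u)"
proof -
  have "abs_sum (edge_functional w) (weigh w u)
      = (\<Sum>(x, y)\<in>UNIV \<times> UNIV. \<bar>u $ y - u $ x\<bar> * w x y / 2)"
    unfolding abs_sum_def UNIV_Times_UNIV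
    by (intro sum.cong)
      (auto simp: edge_functional_def inner_diff_left inner_axis' weigh_def abs_mult weight_nonneg)
  then show ?thesis
    unfolding TV_def sum.cartesian_product[symmetric]
    by (simp add: sum_distrib_left)
qed

lemma Delta1_iff:
  "v \<in> Delta1 w u \<longleftrightarrow> - weigh w v \<in> subgradients (abs_sum (edge_functional w)) (weigh w u)"
proof -
  have "v \<in> Delta1 w u \<longleftrightarrow> (\<forall>z. abs_sum (edge_functional w) (weigh w u)
      + (- weigh w v) \<bullet> (weigh w z - weigh w u) \<le> abs_sum (edge_functional w) (weigh w z))"
    by (simp add: Delta1_def TV_eq_abs_sum inner_weigh flip: weigh_diff)
  also have "\<dots> \<longleftrightarrow> (\<forall>a. abs_sum (edge_functional w) (weigh w u)
      + (- weigh w v) \<bullet> (a - weigh w u) \<le> abs_sum (edge_functional w) a)"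
    by (metis weigh_unweigh(1))
  finally show ?thesis by (simp add: subgradients_def)
qed

lemma strong_solution_iff:
  "strong_solution w u\<^sub>0 u \<longleftrightarrow>
     u 0 = u\<^sub>0 \<and> gradient_flow (abs_sum (edge_functional w)) (\<lambda>t. weigh w (u t))"
proof
  assume "strong_solution w u\<^sub>0 u"
  then obtain g where "u 0 = u\<^sub>0" and g: "\<And>T. T > 0 \<Longrightarrow> W11_derivative T u g"
    "AE t in lborel. t > 0 \<longrightarrow> g t \<in> Delta1 w (u t)"
    by (auto simp: strong_solution_def)
  then show "u 0 = u\<^sub>0 \<and> gradient_flow (abs_sum (edge_functional w)) (\<lambda>t. weigh w (u t))"
    unfolding gradient_flow_def
    by (intro conjI exI[of _ "\<lambda>t. weigh w (g t)"] allI impI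
        W11_derivative_bounded_linear[OF bounded_linear_weigh])
      (auto simp: Delta1_iff)
next
  assume "u 0 = u\<^sub>0 \<and> gradient_flow (abs_sum (edge_functional w)) (\<lambda>t. weigh w (u t))"
  then obtain g where "u 0 = u\<^sub>0"
    and g: "\<And>T. T > 0 \<Longrightarrow> W11_derivative T (\<lambda>t. weigh w (u t)) g"
      "AE t in lborel. t > 0 \<longrightarrow> - g t \<in> subgradients (abs_sum (edge_functional w)) (weigh w (u t))"
    by (auto simp: gradient_flow_def)
  moreover have "W11_derivative T u (\<lambda>t. unweigh w (g t))" if "T > 0" for T
    using W11_derivative_bounded_linear[OF bounded_linear_unweigh g(1)[OF that], of w] by simp
  ultimately show "strong_solution w u\<^sub>0 u"
    unfolding strong_solution_def
    by (intro conjI exI[of _ "\<lambda>t. unweigh w (g t)"]) (auto simp: Delta1_iff)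
qed

lemma strong_solution_unique:
  assumes "strong_solution w u\<^sub>0 u" "strong_solution w u\<^sub>0 v" "t \<ge> 0"
  shows "u t = v t"
  using assms gradient_flow_unique[of "edge_functional w" "\<lambda>t. weigh w (u t)" "\<lambda>t. weigh w (v t)" t]
  by (auto simp: strong_solution_iff) (metis weigh_unweigh(2))

lemma strong_solution_restrict:
  assumes "strong_solution w u\<^sub>0 u"
  shows "strong_solution w u\<^sub>0 (restrict u {0..})"
proof -
  have "W11_derivative T (restrict u {0..}) g" if "T > 0" "W11_derivative T u g" for T g
    unfolding W11_derivative_def
  proof (intro conjI ballI)
    fix t assume t: "t \<in> {0..T}"
    then have "u t = u 0 + (LINT s:{0..t}|lborel. g s)"
      using that(2) unfolding W11_derivative_def by blast
    then show "restrict u {0..} t = restrict u {0..} 0 + (LINT s:{0..t}|lborel. g s)"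
      using t by simp
  qed (use that(2) in \<open>simp add: W11_derivative_def\<close>)
  moreover obtain g where "u 0 = u\<^sub>0" "\<And>T. T > 0 \<Longrightarrow> W11_derivative T u g"
    "AE t in lborel. t > 0 \<longrightarrow> g t \<in> Delta1 w (u t)"
    using assms by (auto simp: strong_solution_def)
  ultimately show ?thesis
    unfolding strong_solution_def by (intro conjI exI[of _ g]) auto
qed

lemma TV_flow_eq:
  assumes "strong_solution w u\<^sub>0 u" "t \<ge> 0"
  shows "TV_flow w u\<^sub>0 t = u t"
proof -
  have "TV_flow w u\<^sub>0 = restrict u {0..}"
    unfolding TV_flow_def
  proof (rule the_equality)
    show "restrict u {0..} \<in> extensional {0..} \<and> strong_solution w u\<^sub>0 (restrict u {0..})"
      using strong_solution_restrict[OF assms(1)] by simp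
    fix v assume "v \<in> extensional {0..} \<and> strong_solution w u\<^sub>0 v"
    then show "v = restrict u {0..}"
      using strong_solution_unique[OF _ assms(1)]
      by (intro extensionalityI[of _ "{0..}"]) auto
  qed
  then show ?thesis using assms(2) by simp
qed

lemma total_weight_pos: "(\<Sum>x\<in>UNIV. deg w x) > 0"
  by (intro sum_pos) (auto simp: deg_pos)

lemma integral_minus_mean: "(\<integral>x. (u - vec (mean w u)) $ x \<partial>nu w) = 0"
proof -
  have "measure (nu w) UNIV = (\<Sum>x\<in>UNIV. deg w x)"
    using lebesgue_integral_point_measure_finite[of UNIV "deg w" "\<lambda>_. 1 :: real"]
    by (simp add: nu_def measure_point_measure_finite_if)
  then have "(\<Sum>x\<in>UNIV. deg w x) * mean w u = (\<Sum>x\<in>UNIV. deg w x * u $ x)"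
    using total_weight_pos by (simp add: mean_def integral_nu)
  then show ?thesis
    by (simp add: integral_nu right_diff_distrib sum_subtractf sum_distrib_right)
qed

lemma TV_vec: "TV w (vec k) = 0"
  by (simp add: TV_def)

lemma TV_eq_0_imp_const:
  assumes "TV w u = 0"
  shows "u $ x = u $ y"
proof -
  have "(\<Sum>x\<in>UNIV. \<Sum>y\<in>UNIV. \<bar>u $ y - u $ x\<bar> * w x y) = 0"
    using assms by (simp add: TV_def)
  then have "\<bar>u $ y - u $ x\<bar> * w x y = 0" for x y
    by (simp add: sum_nonneg_eq_0_iff sum_nonneg weight_nonneg)
  then have edge: "u $ y = u $ x" if "(x, y) \<in> E" for x y
    using weight_pos[OF that] by (metis abs_eq_0 less_irrefl mult_eq_0_iff right_minus_eq)
  have "(x, y) \<in> E\<^sup>*" by (rule connected)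
  then show ?thesis by induction (auto simp: edge)
qed

text \<open>
  The total variation is continuous, and positive on the compact set of mean-zero functions of norm
  one; its minimum there is a valid constant by homogeneity. On a single vertex this set is empty.
\<close>

lemma Poincare_inequality:
  obtains C where "C > 0" "\<And>u. (\<integral>x. u $ x \<partial>nu w) = 0 \<Longrightarrow> C * L2_norm w u \<le> TV w u"
proof -
  define F where "F = abs_sum (edge_functional w)"
  define K where "K = sphere 0 1 \<inter> {a. a \<bullet> weigh w (vec 1) = 0}"
  have pos: "F a > 0" if "a \<in> K" for a
  proof (rule ccontr)
    define u where "u = unweigh w a"
    assume "\<not> F a > 0"
    then have "TV w u = 0"
      using abs_sum_nonneg[of "edge_functional w" a] by (simp add: F_def u_def TV_eq_abs_sum)
    then have const: "u $ x = u $ y" for x y by (rule TV_eq_0_imp_const)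
    fix x\<^sub>0 :: 'v
    have u: "u = vec (u $ x\<^sub>0)" using const by (simp add: vec_eq_iff)
    have "(\<integral>x. u $ x \<partial>nu w) = 0"
      using that by (simp add: integral_eq_inner u_def K_def)
    then have "(\<Sum>x\<in>UNIV. deg w x) * u $ x\<^sub>0 = 0"
      by (subst (asm) u) (simp add: integral_nu sum_distrib_right)
    then have "u = 0" using total_weight_pos u by (simp add: vec_eq_iff const)
    then have "a = 0" by (metis u_def weigh_eq_0_iff weigh_unweigh(1))
    then show False using that by (simp add: K_def)
  qed
  obtain C where C: "C > 0" "\<And>a. a \<in> K \<Longrightarrow> C \<le> F a"
  proof (cases "K = {}")
    case False
    have "compact K"
      unfolding K_def by (intro compact_Int_closed compact_sphere closed_Collect_eq continuous_intros)
    then obtain a where "a \<in> K" "\<And>b. b \<in> K \<Longrightarrow> F a \<le> F b"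
      using continuous_attains_inf[OF _ False, of F] by (auto simp: F_def continuous_on_abs_sum)
    with pos that show ?thesis by blast
  qed (use that[of 1] in auto)
  have "C * L2_norm w u \<le> TV w u" if "(\<integral>x. u $ x \<partial>nu w) = 0" for u
  proof (cases "weigh w u = 0")
    case False
    define a where "a = weigh w u"
    have a: "norm a > 0" "a \<bullet> weigh w (vec 1) = 0"
      using that False by (simp_all add: a_def integral_eq_inner)
    then have "(1 / norm a) *\<^sub>R a \<in> K" by (simp add: K_def)
    from C(2)[OF this] have "C \<le> F a / norm a"
      by (simp add: F_def abs_sum_scale)
    then have "C * norm a \<le> F a" using a(1) by (simp add: field_simps)
    then show ?thesis by (simp add: a_def F_def TV_eq_abs_sum norm_weigh)
  qed (simp add: TV_eq_abs_sum abs_sum_nonneg flip: norm_weigh)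
  with C(1) that show ?thesis by blast
qed

text \<open>
  The rate \<open>lam\<close> is left general, because on a single vertex the infimum in \<open>lambda2 w\<close> is over the
  empty set, whereas any positive rate is admissible.
\<close>

lemma TV_flow_decay:
  assumes lam: "lam > 0" "\<And>u. (\<integral>x. u $ x \<partial>nu w) = 0 \<Longrightarrow> lam * L2_norm w u \<le> TV w u"
    and "t \<ge> 0"
  shows "L2_norm w (TV_flow w u\<^sub>0 t - vec (mean w u\<^sub>0))
    \<le> max (L2_norm w (u\<^sub>0 - vec (mean w u\<^sub>0)) - lam * t) 0"
proof -
  define m :: "real ^ 'v" where "m = vec (mean w u\<^sub>0)"
  obtain a where a: "a 0 = weigh w u\<^sub>0" "polygonal_flow (abs_sum (edge_functional w)) a"
    using polygonal_flow_exists by blast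
  have "strong_solution w u\<^sub>0 (\<lambda>t. unweigh w (a t))"
    using a polygonal_flow_gradient_flow by (simp add: strong_solution_iff)
  then have flow: "weigh w (TV_flow w u\<^sub>0 t - m) = a t - weigh w m"
    using TV_flow_eq \<open>t \<ge> 0\<close> by (simp add: weigh_diff)
  have "norm (a t - weigh w m) \<le> max (norm (a 0 - weigh w m) - lam * t) 0"
  proof (rule polygonal_flow_decay[OF a(2) lam(1), where e = "weigh w (vec 1)"])
    show "lam * norm z \<le> abs_sum (edge_functional w) z" if "z \<bullet> weigh w (vec 1) = 0" for z
      using lam(2)[of "unweigh w z"] that
      by (simp add: integral_eq_inner TV_eq_abs_sum flip: norm_weigh)
    show "(a 0 - weigh w m) \<bullet> weigh w (vec 1) = 0"
      using integral_minus_mean[of u\<^sub>0]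
      by (simp add: a(1) m_def integral_eq_inner weigh_diff del: vector_minus_component)
  qed (use \<open>t \<ge> 0\<close> in \<open>simp_all add: m_def TV_vec TV_vec[of 1, simplified] flip: TV_eq_abs_sum\<close>)
  then show ?thesis
    by (simp only: a(1) flow[symmetric] weigh_diff[symmetric] norm_weigh m_def[symmetric])
qed

text \<open>
  The function \<open>v\<close> witnesses that the infimum is over a nonempty set.
\<close>

lemma lambda2_pos_and_bound:
  assumes "L2_norm w v \<noteq> 0" "(\<integral>x. v $ x \<partial>nu w) = 0"
  shows "lambda2 w > 0" "(\<integral>x. u $ x \<partial>nu w) = 0 \<Longrightarrow> lambda2 w * L2_norm w u \<le> TV w u"
proof -
  define Q where "Q = {TV w u / L2_norm w u | u. L2_norm w u \<noteq> 0 \<and> (\<integral>x. u $ x \<partial>nu w) = 0}"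
  have norm_nonneg: "L2_norm w u \<ge> 0" for u by (simp flip: norm_weigh)
  obtain C where C: "C > 0" "\<And>u. (\<integral>x. u $ x \<partial>nu w) = 0 \<Longrightarrow> C * L2_norm w u \<le> TV w u"
    using Poincare_inequality by blast
  have low: "C \<le> q" if q: "q \<in> Q" for q
  proof -
    obtain u where u: "q = TV w u / L2_norm w u" "L2_norm w u \<noteq> 0" "(\<integral>x. u $ x \<partial>nu w) = 0"
      using q unfolding Q_def by blast
    then have "L2_norm w u > 0" using norm_nonneg[of u] by simp
    then show ?thesis using C(2)[OF u(3)] u(1) by (simp add: le_divide_eq)
  qed
  have "Q \<noteq> {}" using assms by (auto simp: Q_def)
  then have "C \<le> Inf Q" using low by (rule cInf_greatest)
  then show "lambda2 w > 0" using C(1) by (simp add: lambda2_def Q_def)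
  show "lambda2 w * L2_norm w u \<le> TV w u" if "(\<integral>x. u $ x \<partial>nu w) = 0"
  proof (cases "L2_norm w u = 0")
    case True
    then show ?thesis by (simp add: TV_eq_abs_sum abs_sum_nonneg)
  next
    case False
    have "Inf Q \<le> TV w u / L2_norm w u"
      using False that low by (intro cInf_lower bdd_belowI[of Q C]) (auto simp: Q_def)
    then show ?thesis
      using False norm_nonneg[of u] by (simp add: lambda2_def Q_def le_divide_eq)
  qed
qed

end

theorem theorem4p11:
  fixes E :: "('v::finite \<times> 'v) set" and w :: "'v \<Rightarrow> 'v \<Rightarrow> real"
    and u\<^sub>0 :: "real ^ 'v" and t_hat :: real
  assumes "weighted_connected_graph E w"
    and "t_hat = L2_norm w (u\<^sub>0 - vec (mean w u\<^sub>0)) / lambda2 w"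
  shows "(\<forall>t\<ge>0. L2_norm w (TV_flow w u\<^sub>0 t - vec (mean w u\<^sub>0)) \<le> lambda2 w * max (t_hat - t) 0)
       \<and> (\<forall>t\<ge>t_hat. TV_flow w u\<^sub>0 t = vec (mean w u\<^sub>0))"
proof -
  interpret weighted_connected_graph E w by fact
  define m :: "real ^ 'v" where "m = vec (mean w u\<^sub>0)"
  have "0 \<le> t_hat \<and> (\<forall>t\<ge>0. L2_norm w (TV_flow w u\<^sub>0 t - m) \<le> lambda2 w * max (t_hat - t) 0)"
  proof (cases "\<exists>v. L2_norm w v \<noteq> 0 \<and> (\<integral>x. v $ x \<partial>nu w) = 0")
    case True
    then obtain v where "L2_norm w v \<noteq> 0" "(\<integral>x. v $ x \<partial>nu w) = 0" by blast
    note lam = lambda2_pos_and_bound[OF this]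
    have "max (L2_norm w (u\<^sub>0 - m) - lambda2 w * t) 0 = lambda2 w * max (t_hat - t) 0" for t
      using lam(1) by (simp add: assms(2) m_def max_mult_distrib_left right_diff_distrib)
    moreover have "0 \<le> t_hat"
      using lam(1) by (simp add: assms(2) flip: norm_weigh)
    ultimately show ?thesis
      using TV_flow_decay[OF lam, of _ u\<^sub>0] by (simp add: m_def)
  next
    \<comment> \<open>On a single vertex \<open>lambda2 w\<close> carries no information. But \<open>u\<^sub>0\<close> is its own mean there, so
      \<open>t_hat = 0\<close>, and decay at rate \<open>1\<close> shows that the flow does not move.\<close>
    case False
    then have "L2_norm w (u\<^sub>0 - m) = 0"
      using integral_minus_mean[of u\<^sub>0] unfolding m_def by blast
    moreover have "1 * L2_norm w u \<le> TV w u" if "(\<integral>x. u $ x \<partial>nu w) = 0" for u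
    proof -
      have "L2_norm w u = 0" using that False by blast
      then show ?thesis by (simp add: TV_eq_abs_sum abs_sum_nonneg)
    qed
    from TV_flow_decay[OF _ this, of _ u\<^sub>0]
    have "L2_norm w (TV_flow w u\<^sub>0 t - m) \<le> max (L2_norm w (u\<^sub>0 - m) - 1 * t) 0" if "t \<ge> 0" for t
      using that by (simp add: m_def)
    ultimately show ?thesis
      by (simp add: assms(2) flip: m_def)
  qed
  then have "0 \<le> t_hat"
    and decay: "\<And>t. t \<ge> 0 \<Longrightarrow> L2_norm w (TV_flow w u\<^sub>0 t - m) \<le> lambda2 w * max (t_hat - t) 0"
    by auto
  moreover have "TV_flow w u\<^sub>0 t = m" if "t \<ge> t_hat" for t
  proof -
    have "norm (weigh w (TV_flow w u\<^sub>0 t - m)) \<le> 0"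
      using decay[of t] that \<open>0 \<le> t_hat\<close> by (simp add: norm_weigh max_def split: if_splits)
    then show ?thesis by (simp add: weigh_eq_0_iff)
  qed
  ultimately show ?thesis by (simp add: m_def)
qed

end
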